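(* Let $\mathcal{M}_1$ and $\mathcal{M}_2$ be $q$-matroids over $\mathbb{F}_q$. Then $\mathbb{P}\mathcal{M}_1\cong\mathbb{P}\mathcal{M}_2$ if and only if $\mathcal{M}_1$ and $\mathcal{M}_2$ are weakly isomorphic. As a consequence, weakly isomorphic $q$-matroids have the same Whitney function.
   Context: A $q$-matroid on a finite-dimensional $\mathbb{F}_q$-space $E$ is $(E,\rho)$ with $\rho$ from subspaces of $E$ to $\mathbb{N}_0$ satisfying $0\le\rho(V)\le\dim V$, monotonicity and submodularity $\rho(V+W)+\rho(V\cap W)\le\rho(V)+\rho(W)$; its Whitney function is $\sum_{V\le E}x^{\rho(E)-\rho(V)}y^{\dim V-\rho(V)}$. The closure of a subspace $V$ is $\mathrm{cl}(V)=\{x\in E:\rho(V+\langle x\rangle)=\rho(V)\}$, and $V$ is a flat if $\mathrm{cl}(V)=V$; the flats form a lattice $\mathcal{F}(\mathcal{M})$ ordered by inclusion with meet $\cap$ and join $V_1\vee V_2=\mathrm{cl}(V_1+V_2)$. $\mathcal{M}_1,\mathcal{M}_2$ are weakly isomorphic if there is a lattice isomorphism $\alpha:\mathcal{F}(\mathcal{M}_1)\to\mathcal{F}(\mathcal{M}_2)$ with $\dim\alpha(F)=\dim F$ for all flats $F$. The projectivization $\mathbb{P}\mathcal{M}$ is the matroid on the set $\mathbb{P}E$ of one-dimensional subspaces of $E$ with rank $r(A)=\rho(\langle A\rangle)$, $\langle A\rangle$ the span of the lines in $A$. Matroids $(S_1,r_1),(S_2,r_2)$ are isomorphic if there is a bijection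 $\beta:S_1\to S_2$ with $r_2(\beta(A))=r_1(A)$ for all $A\subseteq S_1$. *)

theory Defs
  imports "HOL-Library.Set_Algebras" "HOL-Library.FuncSet" "HOL-Computational_Algebra.Polynomial"
begin

text \<open>
  The finite field is the type \<open>'f\<close>; the ground space \<open>E\<close> is a finite-dimensional subspace of an
  arbitrary \<open>'f\<close>-vector space, so that the zero space is included. Only the values of \<open>\<rho>\<close> on
  subspaces of \<open>E\<close> are relevant. Sums \<open>V + W\<close> are the elementwise sums of sets.
\<close>

locale q_matroid = vector_space scale
  for scale :: "'f::{field,finite} \<Rightarrow> 'a::ab_group_add \<Rightarrow> 'a" (infixr \<open>*s\<close> 75) +
  fixes E :: "'a set" and \<rho> :: "'a set \<Rightarrow> nat"
  assumes subspace_E: "subspace E"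
    and finite_dimensional_E: "\<exists>B. finite B \<and> span B = E"
    and rank_le_dim: "\<lbrakk>subspace V; V \<subseteq> E\<rbrakk> \<Longrightarrow> \<rho> V \<le> dim V"
    and rank_mono: "\<lbrakk>subspace V; subspace W; V \<subseteq> W; W \<subseteq> E\<rbrakk> \<Longrightarrow> \<rho> V \<le> \<rho> W"
    and rank_submodular: "\<lbrakk>subspace V; V \<subseteq> E; subspace W; W \<subseteq> E\<rbrakk> \<Longrightarrow>
      \<rho> (V + W) + \<rho> (V \<inter> W) \<le> \<rho> V + \<rho> W"
begin

definition subspaces :: "'a set set" where
  "subspaces = {V. subspace V \<and> V \<subseteq> E}"

definition cl :: "'a set \<Rightarrow> 'a set" where
  "cl V = {x \<in> E. \<rho> (V + span {x}) = \<rho> V}"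

definition flats :: "'a set set" where
  "flats = {V \<in> subspaces. cl V = V}"

definition flat_join :: "'a set \<Rightarrow> 'a set \<Rightarrow> 'a set" where
  "flat_join V W = cl (V + W)"

text \<open>
  A polynomial in \<open>\<int>[x][y]\<close>: the inner variable is \<open>x\<close>, the outer one is \<open>y\<close>. The subtractions
  do not truncate, by \<open>rank_mono\<close> and \<open>rank_le_dim\<close>.
\<close>

definition whitney :: "int poly poly" where
  "whitney = (\<Sum>V\<in>subspaces. monom (monom 1 (\<rho> E - \<rho> V)) (dim V - \<rho> V))"

definition projective_points :: "'a set set" where
  "projective_points = {L \<in> subspaces. dim L = 1}"

text \<open>Matroids are pairs of a ground set and a rank function, relevant only on its subsets.\<close>

definition projectivization :: "'a set set \<times> ('a set set \<Rightarrow> nat)" where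
  "projectivization = (projective_points, \<lambda>A. \<rho> (span (\<Union>A)))"

lemma finite_E: "finite E"
proof -
  obtain B where B: "finite B" "span B = E"
    using finite_dimensional_E by blast
  have "span B \<subseteq> (\<lambda>u. \<Sum>b\<in>B. u b *s b) ` (\<Pi>\<^sub>E b\<in>B. UNIV)"
  proof
    fix x assume "x \<in> span B"
    then obtain u where "x = (\<Sum>b\<in>B. u b *s b)"
      using B(1) by (auto simp: span_finite)
    then have "x = (\<Sum>b\<in>B. restrict u B b *s b)"
      by simp
    then show "x \<in> (\<lambda>u. \<Sum>b\<in>B. u b *s b) ` (\<Pi>\<^sub>E b\<in>B. UNIV)"
      by (intro image_eqI[where x = "restrict u B"]) auto
  qed
  moreover have "finite (\<Pi>\<^sub>E b\<in>B. UNIV :: 'f set)"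
    using B(1) by (intro finite_PiE) auto
  ultimately show ?thesis
    using B(2) finite_surj by blast
qed

lemma finite_subspaces: "finite subspaces"
  by (rule finite_subset[of _ "Pow E"]) (auto simp: subspaces_def finite_E)

end

definition matroid_isomorphic ::
  "'s set \<times> ('s set \<Rightarrow> nat) \<Rightarrow> 't set \<times> ('t set \<Rightarrow> nat) \<Rightarrow> bool" where
  "matroid_isomorphic M N \<longleftrightarrow>
    (\<exists>\<beta>. bij_betw \<beta> (fst M) (fst N) \<and> (\<forall>A. A \<subseteq> fst M \<longrightarrow> snd N (\<beta> ` A) = snd M A))"

definition weakly_isomorphic ::
  "('f::{field,finite} \<Rightarrow> 'a::ab_group_add \<Rightarrow> 'a) \<Rightarrow> 'a set \<Rightarrow> ('a set \<Rightarrow> nat) \<Rightarrow>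
   ('f \<Rightarrow> 'b::ab_group_add \<Rightarrow> 'b) \<Rightarrow> 'b set \<Rightarrow> ('b set \<Rightarrow> nat) \<Rightarrow> bool" where
  "weakly_isomorphic s1 E1 \<rho>1 s2 E2 \<rho>2 \<longleftrightarrow>
    (\<exists>\<alpha>. bij_betw \<alpha> (q_matroid.flats s1 E1 \<rho>1) (q_matroid.flats s2 E2 \<rho>2) \<and>
      (\<forall>F\<in>q_matroid.flats s1 E1 \<rho>1. \<forall>G\<in>q_matroid.flats s1 E1 \<rho>1.
        \<alpha> (F \<inter> G) = \<alpha> F \<inter> \<alpha> G \<and>
        \<alpha> (q_matroid.flat_join s1 E1 \<rho>1 F G) = q_matroid.flat_join s2 E2 \<rho>2 (\<alpha> F) (\<alpha> G)) \<and>
      (\<forall>F\<in>q_matroid.flats s1 E1 \<rho>1. vector_space.dim s2 (\<alpha> F) = vector_space.dim s1 F))"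

end

theory Submission
  imports Defs
begin

text \<open>
  Closures in a \<open>q\<close>-matroid and in its projectivization correspond, and a subspace is determined by
  its points. Hence an isomorphism of projectivizations maps the point sets of flats to point sets
  of flats, and the number of points of a flat determines its dimension. Conversely, an isomorphism
  \<open>\<alpha>\<close> of the lattices of flats preserves ranks, since these are heights, and if it preserves
  dimensions then for every flat \<open>F\<close> and every \<open>d\<close> there are as many \<open>d\<close>-dimensional subspaces with
  closure \<open>F\<close> as with closure \<open>\<alpha> F\<close>. So \<open>\<alpha>\<close> lifts to a bijection \<open>\<phi>\<close> of all subspaces with
  \<open>cl (\<phi> V) = \<alpha> (cl V)\<close> and \<open>dim (\<phi> V) = dim V\<close>. It matches the Whitney functions term by term, and
  its restriction to the points is an isomorphism of the projectivizations.
\<close>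

section \<open>Gluing bijections of fibres, and sums of subspaces\<close>

text \<open>The fibres partition both sets, so bijections chosen fibre by fibre glue together. It
  serves to lift a map of flats to all subspaces, with fibres given by closure and
  dimension.\<close>

lemma bij_betw_if_fibres_equinumerous:
  assumes "finite A" and "finite B"
    and card_eq: "\<And>c. card {a \<in> A. f a = c} = card {b \<in> B. g b = c}"
  shows "\<exists>h. bij_betw h A B \<and> (\<forall>a\<in>A. g (h a) = f a)"
proof -
  have "\<exists>k. bij_betw k {a \<in> A. f a = c} {b \<in> B. g b = c}" for c
    using assms by (intro finite_same_card_bij) auto
  then obtain k where k: "\<And>c. bij_betw (k c) {a \<in> A. f a = c} {b \<in> B. g b = c}"
    by metis
  define h where "h a = k (f a) a" for a
  have h: "h a \<in> B \<and> g (h a) = f a" if "a \<in> A" for a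
    using k[of "f a"] that by (auto simp: h_def bij_betw_def)
  have "inj_on h A"
  proof (rule inj_onI)
    fix a a' assume a: "a \<in> A" "a' \<in> A" "h a = h a'"
    then have "f a = f a'"
      using h by metis
    then show "a = a'"
      using a k[of "f a"] by (auto simp: h_def bij_betw_def inj_on_def)
  qed
  moreover have "h ` A = B"
  proof
    show "B \<subseteq> h ` A"
    proof
      fix b assume "b \<in> B"
      then have "b \<in> k (g b) ` {a \<in> A. f a = g b}"
        using k[of "g b"] by (auto simp: bij_betw_def)
      then obtain a where "a \<in> A" "f a = g b" "b = k (g b) a"
        by blast
      then show "b \<in> h ` A"
        by (intro image_eqI[of _ _ a]) (simp_all add: h_def)
    qed
  qed (use h in auto)
  ultimately show ?thesis
    using h by (intro exI[of _ h]) (simp add: bij_betw_def)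
qed

context vector_space
begin

lemma subspace_set_plus: "subspace V \<Longrightarrow> subspace W \<Longrightarrow> subspace (V + W)"
proof -
  have "V + W = {x + y |x y. x \<in> V \<and> y \<in> W}"
    by (auto simp: set_plus_def)
  then show "subspace V \<Longrightarrow> subspace W \<Longrightarrow> subspace (V + W)"
    by (simp add: subspace_sums)
qed

lemma set_plus_subset_iff:
  assumes "subspace U" and "subspace V" and "subspace W"
  shows "U + V \<subseteq> W \<longleftrightarrow> U \<subseteq> W \<and> V \<subseteq> W"
proof
  assume "U + V \<subseteq> W"
  moreover have "u = u + 0 \<and> v = 0 + v" for u v :: 'b
    by simp
  ultimately show "U \<subseteq> W \<and> V \<subseteq> W"
    using assms(1,2) subspace_0 by (metis set_plus_intro subset_iff)
next
  assume "U \<subseteq> W \<and> V \<subseteq> W"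
  then show "U + V \<subseteq> W"
    using assms(3) by (auto simp: set_plus_def intro: subspace_add)
qed

lemma set_plus_upper:
  assumes "subspace U" and "subspace V"
  shows "U \<subseteq> U + V" and "V \<subseteq> U + V"
  using set_plus_subset_iff[OF assms subspace_set_plus[OF assms]] by auto

lemma span_singleton_subset_iff: "subspace V \<Longrightarrow> span {x} \<subseteq> V \<longleftrightarrow> x \<in> V"
  using span_minimal[of "{x}" V] span_superset[of "{x}"] by auto

lemma subspace_set_plus_absorb: "subspace U \<Longrightarrow> subspace V \<Longrightarrow> V \<subseteq> U \<Longrightarrow> U + V = U"
  by (simp add: set_plus_subset_iff set_plus_upper subset_antisym)

end

section \<open>Rank, closure and flats of a single q-matroid\<close>

context q_matroid
begin

lemma subspaces_iff: "V \<in> subspaces \<longleftrightarrow> subspace V \<and> V \<subseteq> E"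
  by (simp add: subspaces_def)

lemma subspaces_plus: "V \<in> subspaces \<Longrightarrow> W \<in> subspaces \<Longrightarrow> V + W \<in> subspaces"
  by (simp add: subspaces_iff subspace_set_plus set_plus_subset_iff subspace_E)

lemma subspaces_inter: "V \<in> subspaces \<Longrightarrow> W \<in> subspaces \<Longrightarrow> V \<inter> W \<in> subspaces"
  by (auto simp: subspaces_iff subspace_inter)

lemma subspaces_span: "A \<subseteq> E \<Longrightarrow> span A \<in> subspaces"
  by (simp add: subspaces_iff span_minimal subspace_E)

lemma E_in_subspaces: "E \<in> subspaces"
  by (simp add: subspaces_iff subspace_E)

lemma finite_subspace: "V \<in> subspaces \<Longrightarrow> finite V"
  using finite_E finite_subset by (auto simp: subspaces_iff)

lemma rank_mono_subspaces: "V \<in> subspaces \<Longrightarrow> W \<in> subspaces \<Longrightarrow> V \<subseteq> W \<Longrightarrow> \<rho> V \<le> \<rho> W"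
  using rank_mono by (simp add: subspaces_iff)

lemma rank_le_rank_plus: "V \<in> subspaces \<Longrightarrow> W \<in> subspaces \<Longrightarrow> \<rho> V \<le> \<rho> (V + W)"
  using rank_mono_subspaces[of V "V + W"] subspaces_plus[of V W] set_plus_upper[of V W]
  by (simp add: subspaces_iff)

text \<open>Submodularity with a common subspace in place of the intersection, whose rank is bounded
  below by monotonicity.\<close>

lemma rank_plus_le:
  assumes "U \<in> subspaces" "V \<in> subspaces" "W \<in> subspaces" "U \<subseteq> V" "U \<subseteq> W"
  shows "\<rho> (V + W) + \<rho> U \<le> \<rho> V + \<rho> W"
  using rank_submodular[of V W] rank_mono_subspaces[of U "V \<inter> W"] assms
  by (force simp: subspaces_iff subspace_inter)

lemma rank_zero: "\<rho> {0} = 0"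
  using rank_le_dim[of "{0}"] dim_le_card[of "{0}" "{}"] subspace_0[OF subspace_E] by simp

lemma rank_plus_singleton_le:
  assumes "V \<in> subspaces" "x \<in> E"
  shows "\<rho> (V + span {x}) \<le> \<rho> V + 1"
proof -
  have "\<rho> (span {x}) \<le> 1"
    using rank_le_dim[of "span {x}"] dim_le_card[of "{x}" "{x}"] span_superset[of "{x}"]
      subspaces_span[of "{x}"] assms by (simp add: subspaces_iff)
  then show ?thesis
    using rank_submodular[of V "span {x}"] subspaces_span[of "{x}"] assms
    by (simp add: subspaces_iff)
qed

text \<open>
  A maximal subspace of rank \<open>\<rho> V\<close> above \<open>V\<close> absorbs every \<open>x\<close> with \<open>\<rho> (V + \<langle>x\<rangle>) = \<rho> V\<close>, by
  submodularity, and is therefore the closure of \<open>V\<close>.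
\<close>

lemma cl_maximal:
  assumes V: "V \<in> subspaces"
  shows "cl V \<in> subspaces \<and> V \<subseteq> cl V \<and> \<rho> (cl V) = \<rho> V"
proof -
  let ?S = "{U \<in> subspaces. V \<subseteq> U \<and> \<rho> U = \<rho> V}"
  have S: "finite ?S" "V \<in> ?S"
    using V finite_subspaces by auto
  obtain U where U: "U \<in> ?S" and max: "\<forall>W\<in>?S. U \<subseteq> W \<longrightarrow> U = W"
    using finite_has_maximal2[OF S] by (elim bexE conjE)
  have "x \<in> U" if x: "x \<in> cl V" for x
  proof -
    have xE: "x \<in> E" "\<rho> (V + span {x}) = \<rho> V"
      using x by (auto simp: cl_def)
    have sx: "span {x} \<in> subspaces"
      using xE subspaces_span by auto
    let ?W = "U + (V + span {x})"
    have sp: "V + span {x} \<in> subspaces" "?W \<in> subspaces"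
      using U V sx subspaces_plus by auto
    have up: "V \<subseteq> V + span {x}" "span {x} \<subseteq> V + span {x}" "U \<subseteq> ?W" "V + span {x} \<subseteq> ?W"
      using U V sx sp set_plus_upper by (auto simp: subspaces_iff)
    have "\<rho> ?W + \<rho> V \<le> \<rho> U + \<rho> V"
      using rank_plus_le[of V U "V + span {x}"] U V sp up xE by auto
    moreover have "\<rho> U \<le> \<rho> ?W"
      using rank_le_rank_plus[of U "V + span {x}"] U sp by simp
    ultimately have "?W = U"
      using bspec[OF max, of ?W] U sp up by auto
    then show "x \<in> U"
      using up span_base[of x "{x}"] by auto
  qed
  moreover have "x \<in> cl V" if x: "x \<in> U" for x
  proof -
    have xE: "x \<in> E"
      using U x by (auto simp: subspaces_iff)
    have sx: "span {x} \<in> subspaces"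
      using xE subspaces_span by auto
    have "V + span {x} \<subseteq> U"
      using U V x sx by (auto simp: subspaces_iff set_plus_subset_iff span_singleton_subset_iff)
    then have "\<rho> (V + span {x}) \<le> \<rho> V"
      using rank_mono_subspaces[of "V + span {x}" U] U V sx subspaces_plus by auto
    moreover have "\<rho> V \<le> \<rho> (V + span {x})"
      using rank_le_rank_plus V sx by simp
    ultimately show ?thesis
      using xE by (auto simp: cl_def)
  qed
  ultimately have "cl V = U"
    by blast
  then show ?thesis
    using U by auto
qed

lemma cl_in_subspaces: "V \<in> subspaces \<Longrightarrow> cl V \<in> subspaces"
  and subset_cl: "V \<in> subspaces \<Longrightarrow> V \<subseteq> cl V"
  and rank_cl: "V \<in> subspaces \<Longrightarrow> \<rho> (cl V) = \<rho> V"
  using cl_maximal by auto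

text \<open>The definition of \<open>cl\<close> tests single vectors; this tests a whole subspace at
  once. If \<open>W\<close> lies in \<open>cl V\<close>, then \<open>V + W\<close> is squeezed
  between \<open>V\<close> and \<open>cl V\<close>, which have equal rank; conversely, for
  \<open>x\<close> in \<open>W\<close>, \<open>V + span {x}\<close> is squeezed between
  \<open>V\<close> and \<open>V + W\<close>.\<close>

lemma subset_cl_iff:
  assumes V: "V \<in> subspaces" and W: "W \<in> subspaces"
  shows "W \<subseteq> cl V \<longleftrightarrow> \<rho> (V + W) = \<rho> V"
proof
  assume "W \<subseteq> cl V"
  then have "V + W \<subseteq> cl V"
    using V W cl_in_subspaces[OF V] subset_cl[OF V]
    by (simp add: subspaces_iff set_plus_subset_iff)
  then have "\<rho> (V + W) \<le> \<rho> V"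
    using rank_mono_subspaces[of "V + W" "cl V"] V W subspaces_plus cl_in_subspaces rank_cl by auto
  moreover have "\<rho> V \<le> \<rho> (V + W)"
    using rank_le_rank_plus V W by simp
  ultimately show "\<rho> (V + W) = \<rho> V"
    by simp
next
  assume eq: "\<rho> (V + W) = \<rho> V"
  show "W \<subseteq> cl V"
  proof
    fix x assume x: "x \<in> W"
    then have xE: "x \<in> E"
      using W by (auto simp: subspaces_iff)
    have sx: "span {x} \<in> subspaces" "span {x} \<subseteq> W"
      using xE subspaces_span x W by (auto simp: subspaces_iff span_singleton_subset_iff)
    have "V + span {x} \<subseteq> V + W"
      using sx by (intro set_plus_mono2) auto
    then have "\<rho> (V + span {x}) \<le> \<rho> V"
      using rank_mono_subspaces[of "V + span {x}" "V + W"] eq V W sx subspaces_plus by auto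
    moreover have "\<rho> V \<le> \<rho> (V + span {x})"
      using rank_le_rank_plus V sx by simp
    ultimately show "x \<in> cl V"
      using xE by (auto simp: cl_def)
  qed
qed

text \<open>Enlarging \<open>V\<close> to \<open>cl V\<close> gains no rank, so by submodularity
  adding \<open>cl V\<close> to the larger \<open>W\<close> gains none either.\<close>

lemma cl_mono:
  assumes V: "V \<in> subspaces" and W: "W \<in> subspaces" and "V \<subseteq> W"
  shows "cl V \<subseteq> cl W"
proof -
  have "\<rho> (W + cl V) + \<rho> V \<le> \<rho> W + \<rho> (cl V)"
    using rank_plus_le[of V W "cl V"] assms cl_in_subspaces subset_cl by auto
  then have "\<rho> (W + cl V) \<le> \<rho> W"
    using rank_cl[OF V] by simp
  moreover have "\<rho> W \<le> \<rho> (W + cl V)"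
    using rank_le_rank_plus W cl_in_subspaces[OF V] by simp
  ultimately show ?thesis
    using subset_cl_iff V W cl_in_subspaces by simp
qed

lemma flats_iff: "F \<in> flats \<longleftrightarrow> F \<in> subspaces \<and> cl F = F"
  by (simp add: flats_def)

text \<open>Closing twice keeps the rank at \<open>\<rho> V\<close>, so \<open>subset_cl_iff\<close>
  puts the double closure inside \<open>cl V\<close>.\<close>

lemma cl_in_flats:
  assumes V: "V \<in> subspaces"
  shows "cl V \<in> flats"
proof -
  let ?C = "cl (cl V)"
  have C: "?C \<in> subspaces" "V \<subseteq> ?C" "\<rho> ?C = \<rho> V"
    using V cl_in_subspaces subset_cl[OF V] subset_cl[of "cl V"] rank_cl by auto
  then have "V + ?C = ?C"
    using V subspace_set_plus_absorb[of ?C V] by (simp add: subspaces_iff add.commute)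
  then have "?C \<subseteq> cl V"
    using subset_cl_iff[OF V C(1)] C by simp
  then show ?thesis
    using V cl_in_subspaces subset_cl[of "cl V"] by (simp add: flats_iff subset_antisym)
qed

text \<open>This makes \<open>cl V\<close> the least flat above \<open>V\<close>, so that meets,
  joins and closures can be handled through the order of the flats.\<close>

lemma cl_subset_flat_iff: "V \<in> subspaces \<Longrightarrow> F \<in> flats \<Longrightarrow> cl V \<subseteq> F \<longleftrightarrow> V \<subseteq> F"
  using cl_mono[of V F] subset_cl[of V] by (auto simp: flats_iff)

lemma flats_inter:
  assumes "F \<in> flats" "G \<in> flats"
  shows "F \<inter> G \<in> flats"
  using assms cl_subset_flat_iff[of "F \<inter> G" F] cl_subset_flat_iff[of "F \<inter> G" G]
    subspaces_inter[of F G] subset_cl[of "F \<inter> G"]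
  by (auto simp: flats_iff)

lemma E_in_flats: "E \<in> flats"
  using cl_in_subspaces[OF E_in_subspaces] subset_cl[OF E_in_subspaces] E_in_subspaces
  by (auto simp: flats_iff subspaces_iff)

lemma finite_flats: "finite flats"
  using finite_subspaces by (simp add: flats_def)

lemma flat_join_in_flats: "F \<in> flats \<Longrightarrow> G \<in> flats \<Longrightarrow> flat_join F G \<in> flats"
  unfolding flat_join_def by (intro cl_in_flats subspaces_plus) (simp_all add: flats_iff)

lemma flat_join_subset_iff:
  assumes "F \<in> flats" "G \<in> flats" "H \<in> flats"
  shows "flat_join F G \<subseteq> H \<longleftrightarrow> F \<subseteq> H \<and> G \<subseteq> H"
proof -
  have "F + G \<in> subspaces"
    using assms subspaces_plus by (simp add: flats_iff)
  then have "flat_join F G \<subseteq> H \<longleftrightarrow> F + G \<subseteq> H"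
    using assms by (simp add: flat_join_def cl_subset_flat_iff)
  also have "\<dots> \<longleftrightarrow> F \<subseteq> H \<and> G \<subseteq> H"
    using assms by (intro set_plus_subset_iff) (simp_all add: flats_iff subspaces_iff)
  finally show ?thesis .
qed

lemma rank_flat_strict_mono:
  assumes F: "F \<in> flats" and G: "G \<in> flats" and "F \<subset> G"
  shows "\<rho> F < \<rho> G"
proof -
  have "\<rho> (F + G) \<noteq> \<rho> F"
    using subset_cl_iff[of F G] assms by (auto simp: flats_iff)
  moreover have "F + G = G"
    using subspace_set_plus_absorb[of G F] assms by (auto simp: flats_iff subspaces_iff add.commute)
  ultimately show ?thesis
    using rank_mono_subspaces[of F G] assms by (auto simp: flats_iff)
qed

text \<open>A maximal flat strictly below \<open>F\<close> has corank one, since one extra vector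
  already generates \<open>F\<close> up to closure. This ties the rank to the height in the lattice
  of flats.\<close>

lemma flat_below:
  assumes F: "F \<in> flats" and "\<rho> F > 0"
  obtains G where "G \<in> flats" "G \<subset> F" "\<rho> F \<le> \<rho> G + 1"
proof -
  have z: "{0} \<in> subspaces" "{0} \<subseteq> F"
    using F subspace_0[of F] by (auto simp: flats_iff subspaces_iff)
  \<comment> \<open>\<open>cl {0}\<close> has rank zero and \<open>F\<close> does not, so some flat
    lies strictly below \<open>F\<close>.\<close>
  have "cl {0} \<subseteq> F" "cl {0} \<noteq> F"
    using z F assms cl_subset_flat_iff rank_cl[OF z(1)] rank_zero by auto
  then have S: "finite {G \<in> flats. G \<subset> F}" "cl {0} \<in> {G \<in> flats. G \<subset> F}"
    using finite_flats cl_in_flats[OF z(1)] by auto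
  obtain G where "G \<in> {G \<in> flats. G \<subset> F}"
    and max: "\<forall>H\<in>{G \<in> flats. G \<subset> F}. G \<subseteq> H \<longrightarrow> G = H"
    using finite_has_maximal2[OF S] by (elim bexE conjE)
  then have G: "G \<in> flats" "G \<subset> F"
    by simp_all
  obtain x where x: "x \<in> F" "x \<notin> G"
    using G by auto
  have xE: "x \<in> E"
    using x F by (auto simp: flats_iff subspaces_iff)
  let ?H = "G + span {x}"
  have sx: "span {x} \<in> subspaces"
    using subspaces_span xE by auto
  then have H: "?H \<in> subspaces" "G \<subseteq> ?H" "span {x} \<subseteq> ?H" "?H \<subseteq> F"
    using G F x subspaces_plus set_plus_upper
    by (auto simp: flats_iff subspaces_iff set_plus_subset_iff span_singleton_subset_iff)
  have "x \<in> cl ?H"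
    using H subset_cl[OF H(1)] span_base[of x "{x}"] by auto
  then have "cl ?H \<noteq> G" "G \<subseteq> cl ?H" "cl ?H \<subseteq> F"
    using x H subset_cl[OF H(1)] cl_subset_flat_iff[OF H(1) F] by auto
  \<comment> \<open>\<open>cl ?H\<close> is a flat strictly above \<open>G\<close> and inside
    \<open>F\<close>, so maximality of \<open>G\<close> leaves only \<open>F\<close>.\<close>
  then have "cl ?H = F"
    using bspec[OF max, of "cl ?H"] cl_in_flats[OF H(1)] by auto
  then have "\<rho> F \<le> \<rho> G + 1"
    using rank_cl[OF H(1)] rank_plus_singleton_le[of G x] G xE by (auto simp: flats_iff)
  then show thesis
    using that G by blast
qed

section \<open>Points and the subspaces they span\<close>

definition points_in :: "'a set \<Rightarrow> 'a set set" where
  "points_in V = {L \<in> projective_points. L \<subseteq> V}"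

lemma points_in_eq: "points_in V = {L \<in> subspaces. L \<subseteq> V \<and> dim L = 1}"
  by (auto simp: points_in_def projective_points_def)

lemma finite_points_in: "finite (points_in V)"
  using finite_subspaces by (simp add: points_in_eq)

lemma span_singleton_in_points:
  assumes "x \<in> E" "x \<noteq> 0"
  shows "span {x} \<in> projective_points"
  using assms subspaces_span[of "{x}"] dim_eq_card_independent[of "{x}"]
  by (simp add: projective_points_def)

lemma Union_points_subset: "A \<subseteq> projective_points \<Longrightarrow> \<Union>A \<subseteq> E"
  by (auto simp: projective_points_def subspaces_iff)

text \<open>Every nonzero vector of \<open>V\<close> spans a point in \<open>V\<close>. Hence ranks
  of sets of points carry the ranks of all subspaces.\<close>

lemma span_points_in:
  assumes V: "V \<in> subspaces"
  shows "span (\<Union>(points_in V)) = V"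
proof
  show "span (\<Union>(points_in V)) \<subseteq> V"
    using V by (intro span_minimal) (auto simp: points_in_def subspaces_iff)
  show "V \<subseteq> span (\<Union>(points_in V))"
  proof
    fix x assume x: "x \<in> V"
    show "x \<in> span (\<Union>(points_in V))"
    proof (cases "x = 0")
      case False
      then have "span {x} \<in> points_in V"
        using x V span_singleton_in_points[of x]
        by (auto simp: points_in_def subspaces_iff span_singleton_subset_iff)
      then show ?thesis
        using span_base[of x "{x}"] by (auto intro: span_base)
    qed (simp add: span_zero)
  qed
qed

lemma points_in_subset_iff:
  assumes "V \<in> subspaces" and "W \<in> subspaces"
  shows "points_in V \<subseteq> points_in W \<longleftrightarrow> V \<subseteq> W"
proof
  assume "points_in V \<subseteq> points_in W"
  then have "span (\<Union>(points_in V)) \<subseteq> span (\<Union>(points_in W))"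
    by (intro span_mono Union_mono)
  then show "V \<subseteq> W"
    using assms by (simp add: span_points_in)
qed (auto simp: points_in_def)

text \<open>Turns the adjunction of a point into a sum of subspaces, so that
  \<open>subset_cl_iff\<close> applies to rank increments in the projectivization.\<close>

lemma span_Union_insert:
  assumes "A \<subseteq> projective_points" "L \<in> projective_points"
  shows "span (\<Union>(insert L A)) = span (\<Union>A) + L"
proof -
  have "span L = L"
    using assms by (simp add: projective_points_def subspaces_iff)
  then have "span (L \<union> \<Union>A) = L + span (\<Union>A)"
    unfolding span_Un by (auto simp only: set_plus_def)
  then show ?thesis
    by (simp add: add.commute)
qed

lemma exists_subspace_of_dim:
  assumes V: "V \<in> subspaces" and n: "n \<le> dim V"
  obtains W where "W \<in> subspaces" "W \<subseteq> V" "dim W = n"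
proof -
  obtain B where B: "B \<subseteq> V" "independent B" "card B = dim V"
    using basis_exists[of V] by metis
  then obtain C where C: "C \<subseteq> B" "card C = n"
    using n obtain_subset_with_card_n by metis
  show thesis
  proof (rule that[of "span C"])
    show "span C \<in> subspaces" "span C \<subseteq> V"
      using B C V span_minimal[of C V] by (auto simp: subspaces_iff)
    show "dim (span C) = n"
      using B C independent_mono dim_eq_card_independent by auto
  qed
qed

end

section \<open>Counting subspaces in two spaces over the same finite field\<close>

locale q_matroid_pair =
  M1: q_matroid scale1 E1 \<rho>1 + M2: q_matroid scale2 E2 \<rho>2
  for scale1 :: "'f::{field,finite} \<Rightarrow> 'a::ab_group_add \<Rightarrow> 'a" and E1 \<rho>1
    and scale2 :: "'f \<Rightarrow> 'b::ab_group_add \<Rightarrow> 'b" and E2 \<rho>2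
begin

sublocale vector_space_pair scale1 scale2
  by unfold_locales

text \<open>Lets one-sided estimates be used in both directions, and inverse maps be treated like
  the maps themselves.\<close>

lemma swap: "q_matroid_pair scale2 E2 \<rho>2 scale1 E1 \<rho>1"
  by unfold_locales

text \<open>Spaces of equal dimension are linearly isomorphic, and an isomorphism matches their
  subspaces dimension by dimension.\<close>

lemma card_subspaces_of_dim_eq:
  assumes V: "V \<in> M1.subspaces" and W: "W \<in> M2.subspaces" and "M1.dim V = M2.dim W"
  shows "card {U \<in> M1.subspaces. U \<subseteq> V \<and> M1.dim U = d} = card {U \<in> M2.subspaces. U \<subseteq> W \<and> M2.dim U = d}"
proof -
  obtain B where B: "B \<subseteq> V" "M1.independent B" "V \<subseteq> M1.span B" "card B = M1.dim V"
    using M1.basis_exists[of V] by metis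
  obtain C where C: "C \<subseteq> W" "M2.independent C" "W \<subseteq> M2.span C" "card C = M2.dim W"
    using M2.basis_exists[of W] by metis
  have sub: "M1.subspace V" "M2.subspace W" "finite V" "finite W"
    using V W M1.finite_subspace M2.finite_subspace by (auto simp: M1.subspaces_iff M2.subspaces_iff)
  obtain f where f: "Vector_Spaces.linear scale1 scale2 f" "f ` V = W" "inj_on f V"
    using finite_basis_to_basis_subspace_isomorphism[OF sub(1,2) assms(3), of B C] B C sub finite_subset
    by metis
  interpret f: Vector_Spaces.linear scale1 scale2 f by fact
  \<comment> \<open>\<open>f\<close> is only known to be injective on \<open>V\<close>; the span of
    a basis of \<open>U\<close> stays inside \<open>V\<close>, so the basis is mapped to a basis of
    the image.\<close>
  have dim_image: "M2.dim (f ` U) = M1.dim U" if U: "M1.subspace U" "U \<subseteq> V" for U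
  proof -
    obtain D where D: "D \<subseteq> U" "M1.independent D" "U \<subseteq> M1.span D" "card D = M1.dim U"
      using M1.basis_exists[of U] by metis
    have "M1.span D \<subseteq> V"
      using D U sub by (intro M1.span_minimal) auto
    then have inj: "inj_on f (M1.span D)"
      using f inj_on_subset by blast
    then have "M2.independent (f ` D)"
      using D f.independent_injective_image by blast
    moreover have "card (f ` D) = card D"
      using inj M1.span_superset[of D] by (intro card_image) (rule inj_on_subset)
    moreover have "f ` U \<subseteq> M2.span (f ` D)"
      using D f.spans_image by blast
    ultimately show ?thesis
      using D M2.dim_unique[of "f ` D" "f ` U"] image_mono[OF D(1), of f] by simp
  qed
  have "bij_betw ((`) f) {U \<in> M1.subspaces. U \<subseteq> V \<and> M1.dim U = d} {U \<in> M2.subspaces. U \<subseteq> W \<and> M2.dim U = d}"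
    unfolding bij_betw_def
  proof
    show "inj_on ((`) f) {U \<in> M1.subspaces. U \<subseteq> V \<and> M1.dim U = d}"
      using f(3) by (auto intro!: inj_onI dest: inj_on_image_eq_iff)
    show "(`) f ` {U \<in> M1.subspaces. U \<subseteq> V \<and> M1.dim U = d} = {U \<in> M2.subspaces. U \<subseteq> W \<and> M2.dim U = d}"
    proof (intro subset_antisym subsetI)
      fix U' assume "U' \<in> (`) f ` {U \<in> M1.subspaces. U \<subseteq> V \<and> M1.dim U = d}"
      then obtain U where U: "M1.subspace U" "U \<subseteq> V" "M1.dim U = d" "U' = f ` U"
        by (auto simp: M1.subspaces_iff)
      then have "f ` U \<subseteq> W"
        using f(2) by blast
      then show "U' \<in> {U \<in> M2.subspaces. U \<subseteq> W \<and> M2.dim U = d}"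
        using U W dim_image f.subspace_image by (simp add: M2.subspaces_iff) blast
    next
      fix U assume U: "U \<in> {U \<in> M2.subspaces. U \<subseteq> W \<and> M2.dim U = d}"
      \<comment> \<open>The full preimage of \<open>U\<close> may leave \<open>V\<close>; its part
        in \<open>V\<close> still maps onto \<open>U\<close>, because \<open>f\<close> maps
        \<open>V\<close> onto \<open>W\<close>.\<close>
      let ?U = "V \<inter> {x. f x \<in> U}"
      have sp: "M1.subspace ?U"
        using U sub f.subspace_linear_preimage M1.subspace_inter by (auto simp: M2.subspaces_iff)
      have im: "f ` ?U = U"
        using U f(2) by auto
      show "U \<in> (`) f ` {U \<in> M1.subspaces. U \<subseteq> V \<and> M1.dim U = d}"
        using dim_image[OF sp] im U V sp by (intro image_eqI[of _ _ ?U]) (auto simp: M1.subspaces_iff)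
    qed
  qed
  then show ?thesis
    by (rule bij_betw_same_card)
qed

text \<open>\<open>W\<close> has a proper subspace \<open>U\<close> of the dimension of
  \<open>V\<close>. It has as many points as \<open>V\<close>, by the previous count with
  \<open>d = 1\<close>, and misses a point of \<open>W\<close>.\<close>

lemma card_points_in_less:
  assumes V: "V \<in> M1.subspaces" and W: "W \<in> M2.subspaces" and "M1.dim V < M2.dim W"
  shows "card (M1.points_in V) < card (M2.points_in W)"
proof -
  obtain U where U: "U \<in> M2.subspaces" "U \<subseteq> W" "M2.dim U = M1.dim V"
    using M2.exists_subspace_of_dim[OF W, of "M1.dim V"] assms by auto
  have "M2.points_in U \<subset> M2.points_in W"
    using M2.points_in_subset_iff[OF U(1) W] M2.points_in_subset_iff[OF W U(1)] U assms by auto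
  then have "card (M2.points_in U) < card (M2.points_in W)"
    using M2.finite_points_in by (rule psubset_card_mono[rotated])
  then show ?thesis
    using card_subspaces_of_dim_eq[of V U 1] U V by (simp add: M1.points_in_eq M2.points_in_eq)
qed

lemma dim_eq_if_card_points_in_eq:
  assumes V: "V \<in> M1.subspaces" and W: "W \<in> M2.subspaces"
    and "card (M1.points_in V) = card (M2.points_in W)"
  shows "M1.dim V = M2.dim W"
proof -
  interpret swap: q_matroid_pair scale2 E2 \<rho>2 scale1 E1 \<rho>1
    by (rule swap)
  show ?thesis
    using card_points_in_less[OF V W] swap.card_points_in_less[OF W V] assms(3)
    by (metis less_irrefl linorder_neqE_nat)
qed

section \<open>Order isomorphisms of the lattices of flats\<close>

text \<open>Induction along \<open>flat_below\<close>: each step down loses at most one in rank,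
  while the image loses at least one. An order isomorphism and its inverse are both strictly
  monotone, so using the bound twice yields equality.\<close>

lemma rank_le_if_strict_mono:
  assumes "\<And>F. F \<in> M1.flats \<Longrightarrow> \<alpha> F \<in> M2.flats"
    and "\<And>F G. F \<in> M1.flats \<Longrightarrow> G \<in> M1.flats \<Longrightarrow> F \<subset> G \<Longrightarrow> \<alpha> F \<subset> \<alpha> G"
    and "F \<in> M1.flats"
  shows "\<rho>1 F \<le> \<rho>2 (\<alpha> F)"
  using assms(3)
proof (induction "\<rho>1 F" arbitrary: F rule: less_induct)
  case less
  show ?case
  proof (cases "\<rho>1 F = 0")
    case False
    then obtain G where G: "G \<in> M1.flats" "G \<subset> F" "\<rho>1 F \<le> \<rho>1 G + 1"
      using M1.flat_below less.prems by auto
    have "\<rho>1 G \<le> \<rho>2 (\<alpha> G)"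
      using G less M1.rank_flat_strict_mono by blast
    moreover have "\<rho>2 (\<alpha> G) < \<rho>2 (\<alpha> F)"
      using G less assms M2.rank_flat_strict_mono by auto
    ultimately show ?thesis
      using G by linarith
  qed simp
qed

text \<open>Meets and joins are greatest lower and least upper bounds, hence determined by the
  order.\<close>

lemma order_iso_imp_weakly_isomorphic:
  assumes bij: "bij_betw \<alpha> M1.flats M2.flats"
    and mono: "\<And>F G. F \<in> M1.flats \<Longrightarrow> G \<in> M1.flats \<Longrightarrow> \<alpha> F \<subseteq> \<alpha> G \<longleftrightarrow> F \<subseteq> G"
    and dim: "\<And>F. F \<in> M1.flats \<Longrightarrow> M2.dim (\<alpha> F) = M1.dim F"
  shows "weakly_isomorphic scale1 E1 \<rho>1 scale2 E2 \<rho>2"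
proof -
  have flat: "\<alpha> F \<in> M2.flats" if "F \<in> M1.flats" for F
    using bij that by (auto simp: bij_betw_def)
  have "\<alpha> (F \<inter> G) = \<alpha> F \<inter> \<alpha> G" if FG: "F \<in> M1.flats" "G \<in> M1.flats" for F G
  proof
    show "\<alpha> (F \<inter> G) \<subseteq> \<alpha> F \<inter> \<alpha> G"
      using FG mono[of "F \<inter> G" F] mono[of "F \<inter> G" G] M1.flats_inter by auto
    have "\<alpha> F \<inter> \<alpha> G \<in> M2.flats"
      using FG flat M2.flats_inter by auto
    \<comment> \<open>The preimage of the meet is a lower bound of \<open>F\<close> and
      \<open>G\<close>; dually, the preimage of the join below is an upper bound.\<close>
    then obtain H where H: "H \<in> M1.flats" "\<alpha> H = \<alpha> F \<inter> \<alpha> G"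
      using bij by (metis bij_betw_imp_surj_on imageE)
    then have "H \<subseteq> F \<inter> G"
      using FG mono[of H F] mono[of H G] by auto
    then show "\<alpha> F \<inter> \<alpha> G \<subseteq> \<alpha> (F \<inter> G)"
      using H FG mono[of H "F \<inter> G"] M1.flats_inter by auto
  qed
  moreover have "\<alpha> (M1.flat_join F G) = M2.flat_join (\<alpha> F) (\<alpha> G)"
    if FG: "F \<in> M1.flats" "G \<in> M1.flats" for F G
  proof
    have j1: "M1.flat_join F G \<in> M1.flats" "F \<subseteq> M1.flat_join F G" "G \<subseteq> M1.flat_join F G"
      using FG M1.flat_join_in_flats[OF FG] M1.flat_join_subset_iff[of F G "M1.flat_join F G"] by simp_all
    have j2: "M2.flat_join (\<alpha> F) (\<alpha> G) \<in> M2.flats"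
      "\<alpha> F \<subseteq> M2.flat_join (\<alpha> F) (\<alpha> G)" "\<alpha> G \<subseteq> M2.flat_join (\<alpha> F) (\<alpha> G)"
      using FG flat M2.flat_join_in_flats[of "\<alpha> F" "\<alpha> G"]
        M2.flat_join_subset_iff[of "\<alpha> F" "\<alpha> G" "M2.flat_join (\<alpha> F) (\<alpha> G)"] by simp_all
    show "M2.flat_join (\<alpha> F) (\<alpha> G) \<subseteq> \<alpha> (M1.flat_join F G)"
      using FG j1 mono flat by (simp add: M2.flat_join_subset_iff)
    obtain H where H: "H \<in> M1.flats" "\<alpha> H = M2.flat_join (\<alpha> F) (\<alpha> G)"
      using bij j2(1) by (metis bij_betw_imp_surj_on imageE)
    then have "F \<subseteq> H" "G \<subseteq> H"
      using FG mono[of F H] mono[of G H] j2 by simp_all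
    then have "M1.flat_join F G \<subseteq> H"
      using FG H by (simp add: M1.flat_join_subset_iff)
    then show "\<alpha> (M1.flat_join F G) \<subseteq> M2.flat_join (\<alpha> F) (\<alpha> G)"
      using H mono[OF j1(1) H(1)] by simp
  qed
  ultimately show ?thesis
    using bij dim unfolding weakly_isomorphic_def by blast
qed

text \<open>Inclusion is the equation \<open>F \<inter> G = F\<close>, which an injective map
  preserving meets both preserves and reflects.\<close>

lemma weakly_isomorphic_imp_order_iso:
  assumes "weakly_isomorphic scale1 E1 \<rho>1 scale2 E2 \<rho>2"
  obtains \<alpha> where "bij_betw \<alpha> M1.flats M2.flats"
    and "\<And>F G. F \<in> M1.flats \<Longrightarrow> G \<in> M1.flats \<Longrightarrow> \<alpha> F \<subseteq> \<alpha> G \<longleftrightarrow> F \<subseteq> G"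
    and "\<And>F. F \<in> M1.flats \<Longrightarrow> M2.dim (\<alpha> F) = M1.dim F"
proof -
  obtain \<alpha> where bij: "bij_betw \<alpha> M1.flats M2.flats"
    and inter: "\<And>F G. F \<in> M1.flats \<Longrightarrow> G \<in> M1.flats \<Longrightarrow> \<alpha> (F \<inter> G) = \<alpha> F \<inter> \<alpha> G"
    and dim: "\<And>F. F \<in> M1.flats \<Longrightarrow> M2.dim (\<alpha> F) = M1.dim F"
    using assms unfolding weakly_isomorphic_def by blast
  have "\<alpha> F \<subseteq> \<alpha> G \<longleftrightarrow> F \<subseteq> G" if FG: "F \<in> M1.flats" "G \<in> M1.flats" for F G
  proof -
    have "\<alpha> F \<subseteq> \<alpha> G \<longleftrightarrow> \<alpha> (F \<inter> G) = \<alpha> F"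
      using inter[OF FG] by auto
    also have "\<dots> \<longleftrightarrow> F \<inter> G = F"
      using inj_on_eq_iff[OF bij_betw_imp_inj_on[OF bij]] FG M1.flats_inter by blast
    finally show ?thesis
      by auto
  qed
  then show thesis
    using that bij dim by blast
qed

section \<open>Lifting a dimension-preserving isomorphism of flats to all subspaces\<close>

context
  fixes \<alpha>
  assumes bij: "bij_betw \<alpha> M1.flats M2.flats"
    and mono: "\<And>F G. F \<in> M1.flats \<Longrightarrow> G \<in> M1.flats \<Longrightarrow> \<alpha> F \<subseteq> \<alpha> G \<longleftrightarrow> F \<subseteq> G"
    and dim_\<alpha>: "\<And>F. F \<in> M1.flats \<Longrightarrow> M2.dim (\<alpha> F) = M1.dim F"
begin

lemma order_iso_flat: "F \<in> M1.flats \<Longrightarrow> \<alpha> F \<in> M2.flats"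
  using bij by (auto simp: bij_betw_def)

lemma order_iso_preimage:
  assumes "G \<in> M2.flats"
  obtains F where "F \<in> M1.flats" "\<alpha> F = G"
  using bij assms by (metis bij_betw_imp_surj_on imageE)

lemma order_iso_psubset_iff: "F \<in> M1.flats \<Longrightarrow> G \<in> M1.flats \<Longrightarrow> \<alpha> F \<subset> \<alpha> G \<longleftrightarrow> F \<subset> G"
  using mono by (auto simp: less_le_not_le)

lemma rank_order_iso:
  assumes F: "F \<in> M1.flats"
  shows "\<rho>2 (\<alpha> F) = \<rho>1 F"
proof (rule antisym)
  show "\<rho>1 F \<le> \<rho>2 (\<alpha> F)"
    using F order_iso_flat order_iso_psubset_iff by (intro rank_le_if_strict_mono) auto
next
  interpret swap: q_matroid_pair scale2 E2 \<rho>2 scale1 E1 \<rho>1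
    by (rule swap)
  \<comment> \<open>The inverse is strictly monotone as well, so the same bound for the swapped pair
    gives the other inequality.\<close>
  let ?\<beta> = "the_inv_into M1.flats \<alpha>"
  have inv: "?\<beta> G \<in> M1.flats" "\<alpha> (?\<beta> G) = G" if "G \<in> M2.flats" for G
    using bij that by (auto simp: bij_betw_def the_inv_into_into f_the_inv_into_f)
  have "\<rho>2 (\<alpha> F) \<le> \<rho>1 (?\<beta> (\<alpha> F))"
    using F order_iso_flat order_iso_psubset_iff inv by (intro swap.rank_le_if_strict_mono) metis+
  then show "\<rho>2 (\<alpha> F) \<le> \<rho>1 F"
    using F bij by (simp add: bij_betw_def the_inv_into_f_f)
qed

text \<open>The ground space is the largest flat on either side. This fixes the constant
  \<open>\<rho> E\<close> in the exponents of the Whitney function.\<close>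

lemma order_iso_E: "\<alpha> E1 = E2"
proof -
  obtain F where F: "F \<in> M1.flats" "\<alpha> F = E2"
    using order_iso_preimage M2.E_in_flats by blast
  then have "E2 \<subseteq> \<alpha> E1"
    using mono[of F E1] M1.E_in_flats by (auto simp: M1.flats_iff M1.subspaces_iff)
  moreover have "\<alpha> E1 \<subseteq> E2"
    using order_iso_flat[OF M1.E_in_flats] by (auto simp: M2.flats_iff M2.subspaces_iff)
  ultimately show ?thesis
    by simp
qed

text \<open>
  Every subspace of a flat \<open>F\<close> spans exactly one flat \<open>G \<subseteq> F\<close>, and the number of \<open>d\<close>-dimensional
  subspaces of \<open>F\<close> only depends on \<open>dim F\<close>; so the numbers of spanning subspaces of the flats are
  determined recursively by the lattice and the dimensions.
\<close>

lemma card_spanning_subspaces: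
  assumes "F \<in> M1.flats"
  shows "card {V \<in> M1.subspaces. M1.cl V = F \<and> M1.dim V = d} =
    card {V \<in> M2.subspaces. M2.cl V = \<alpha> F \<and> M2.dim V = d}"
  using assms
proof (induction "\<rho>1 F" arbitrary: F rule: less_induct)
  case less
  let ?N1 = "\<lambda>G. {V \<in> M1.subspaces. M1.cl V = G \<and> M1.dim V = d}"
  let ?N2 = "\<lambda>G. {V \<in> M2.subspaces. M2.cl V = G \<and> M2.dim V = d}"
  let ?S1 = "{G \<in> M1.flats. G \<subset> F}" and ?S2 = "{G \<in> M2.flats. G \<subset> \<alpha> F}"
  have F: "F \<in> M1.flats" "\<alpha> F \<in> M2.flats"
    using less.prems order_iso_flat by auto
  have fin: "finite (?N1 G)" "finite (?N2 H)" for G H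
    using M1.finite_subspaces M2.finite_subspaces by auto
  \<comment> \<open>The subspaces of \<open>F\<close> are sorted by closure;
    \<open>insert F ?S1\<close> sets apart those with closure \<open>F\<close>, which are to be
    counted.\<close>
  have eq1: "{V \<in> M1.subspaces. V \<subseteq> F \<and> M1.dim V = d} = (\<Union>G\<in>insert F ?S1. ?N1 G)"
    using F M1.cl_subset_flat_iff M1.cl_in_flats by (auto simp: psubset_eq)
  have eq2: "{V \<in> M2.subspaces. V \<subseteq> \<alpha> F \<and> M2.dim V = d} = (\<Union>G\<in>insert (\<alpha> F) ?S2. ?N2 G)"
    using F M2.cl_subset_flat_iff M2.cl_in_flats by (auto simp: psubset_eq)
  have "card (\<Union>G\<in>insert F ?S1. ?N1 G) = (\<Sum>G\<in>insert F ?S1. card (?N1 G))"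
    using M1.finite_flats fin by (intro card_UN_disjoint) auto
  also have "\<dots> = card (?N1 F) + (\<Sum>G\<in>?S1. card (?N1 G))"
    using M1.finite_flats by (intro sum.insert) auto
  finally have sum1: "card {V \<in> M1.subspaces. V \<subseteq> F \<and> M1.dim V = d} =
      card (?N1 F) + (\<Sum>G\<in>?S1. card (?N1 G))"
    by (simp only: eq1)
  have "card (\<Union>G\<in>insert (\<alpha> F) ?S2. ?N2 G) = (\<Sum>G\<in>insert (\<alpha> F) ?S2. card (?N2 G))"
    using M2.finite_flats fin by (intro card_UN_disjoint) auto
  also have "\<dots> = card (?N2 (\<alpha> F)) + (\<Sum>G\<in>?S2. card (?N2 G))"
    using M2.finite_flats by (intro sum.insert) auto
  finally have sum2: "card {V \<in> M2.subspaces. V \<subseteq> \<alpha> F \<and> M2.dim V = d} =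
      card (?N2 (\<alpha> F)) + (\<Sum>G\<in>?S2. card (?N2 G))"
    by (simp only: eq2)
  have "bij_betw \<alpha> ?S1 ?S2"
    unfolding bij_betw_def
  proof
    show "inj_on \<alpha> ?S1"
      using bij by (auto simp: bij_betw_def inj_on_def)
    show "\<alpha> ` ?S1 = ?S2"
    proof (intro subset_antisym subsetI)
      fix G assume G: "G \<in> ?S2"
      then obtain H where "H \<in> M1.flats" "\<alpha> H = G"
        using order_iso_preimage by blast
      then show "G \<in> \<alpha> ` ?S1"
        using G F order_iso_psubset_iff by blast
    next
      fix G assume "G \<in> \<alpha> ` ?S1"
      then obtain H where "H \<in> M1.flats" "H \<subset> F" "G = \<alpha> H"
        by blast
      then show "G \<in> ?S2"
        using F order_iso_flat[of H] order_iso_psubset_iff[of H F] by simp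
    qed
  qed
  then have "(\<Sum>G\<in>?S1. card (?N2 (\<alpha> G))) = (\<Sum>G\<in>?S2. card (?N2 G))"
    by (rule sum.reindex_bij_betw)
  \<comment> \<open>Flats strictly below \<open>F\<close> have smaller rank, so the induction
    hypothesis applies to them. Removing these equal sums from equal totals leaves the
    claim.\<close>
  moreover have "(\<Sum>G\<in>?S1. card (?N1 G)) = (\<Sum>G\<in>?S1. card (?N2 (\<alpha> G)))"
    using less M1.rank_flat_strict_mono by (intro sum.cong) auto
  ultimately show ?case
    using sum1 sum2 card_subspaces_of_dim_eq[of F "\<alpha> F" d] F dim_\<alpha>
    by (simp add: M1.flats_iff M2.flats_iff)
qed

text \<open>Labelling \<open>V\<close> by \<open>\<alpha> (M1.cl V)\<close> on the first side and by
  \<open>M2.cl V\<close> on the second, together with the dimension, gives common labels whose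
  fibres \<open>card_spanning_subspaces\<close> compares.\<close>

lemma order_iso_lift_subspaces:
  "\<exists>\<phi>. bij_betw \<phi> M1.subspaces M2.subspaces \<and>
    (\<forall>V\<in>M1.subspaces. M2.cl (\<phi> V) = \<alpha> (M1.cl V) \<and> M2.dim (\<phi> V) = M1.dim V)"
proof -
  have card_eq: "card {V \<in> M1.subspaces. (\<alpha> (M1.cl V), M1.dim V) = c} =
    card {V \<in> M2.subspaces. (M2.cl V, M2.dim V) = c}" for c
  proof (cases "fst c \<in> M2.flats")
    case True
    then obtain F where F: "F \<in> M1.flats" "\<alpha> F = fst c"
      by (rule order_iso_preimage)
    have "\<alpha> (M1.cl V) = fst c \<longleftrightarrow> M1.cl V = F" if "V \<in> M1.subspaces" for V
      using F M1.cl_in_flats[OF that] bij by (auto simp: bij_betw_def inj_on_def)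
    then have "{V \<in> M1.subspaces. (\<alpha> (M1.cl V), M1.dim V) = c} =
      {V \<in> M1.subspaces. M1.cl V = F \<and> M1.dim V = snd c}"
      by (auto simp: prod_eq_iff)
    then show ?thesis
      using card_spanning_subspaces[OF F(1), of "snd c"] F by (simp add: prod_eq_iff)
  next
    \<comment> \<open>Closures are flats, so no subspace on either side carries this label.\<close>
    case False
    then have empty: "{V \<in> M1.subspaces. (\<alpha> (M1.cl V), M1.dim V) = c} = {}"
      "{V \<in> M2.subspaces. (M2.cl V, M2.dim V) = c} = {}"
      using order_iso_flat M1.cl_in_flats M2.cl_in_flats by auto
    show ?thesis
      unfolding empty by simp
  qed
  show ?thesis
    using bij_betw_if_fibres_equinumerous[OF M1.finite_subspaces M2.finite_subspaces card_eq]
    by simp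
qed

text \<open>A subspace has the rank of its closure, so the lift preserves rank besides
  dimension.\<close>

lemma order_iso_whitney: "M1.whitney = M2.whitney"
proof -
  obtain \<phi> where \<phi>: "bij_betw \<phi> M1.subspaces M2.subspaces"
    "\<And>V. V \<in> M1.subspaces \<Longrightarrow> M2.cl (\<phi> V) = \<alpha> (M1.cl V)"
    "\<And>V. V \<in> M1.subspaces \<Longrightarrow> M2.dim (\<phi> V) = M1.dim V"
    using order_iso_lift_subspaces by blast
  have "\<rho>2 (\<phi> V) = \<rho>1 V" if V: "V \<in> M1.subspaces" for V
    using \<phi>(2)[OF V] rank_order_iso[OF M1.cl_in_flats[OF V]] M1.rank_cl[OF V]
      M2.rank_cl[OF bij_betw_apply[OF \<phi>(1) V]] by simp
  moreover have "\<rho>2 E2 = \<rho>1 E1"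
    using rank_order_iso[OF M1.E_in_flats] order_iso_E by simp
  ultimately show ?thesis
    unfolding M1.whitney_def M2.whitney_def
    using \<phi>(3) by (subst sum.reindex_bij_betw[OF \<phi>(1), symmetric]) (simp cong: sum.cong)
qed

text \<open>The lift \<open>\<phi>\<close> need not respect inclusions or sums, so the spans of a
  set of points and of its image cannot be matched by \<open>\<phi>\<close>. Their closures are
  compared instead, through the flats that contain them.\<close>

lemma order_iso_projectivization:
  "matroid_isomorphic M1.projectivization M2.projectivization"
proof -
  obtain \<phi> where \<phi>: "bij_betw \<phi> M1.subspaces M2.subspaces"
    "\<And>V. V \<in> M1.subspaces \<Longrightarrow> M2.cl (\<phi> V) = \<alpha> (M1.cl V)"
    "\<And>V. V \<in> M1.subspaces \<Longrightarrow> M2.dim (\<phi> V) = M1.dim V"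
    using order_iso_lift_subspaces by blast
  have \<phi>_points: "bij_betw \<phi> M1.projective_points M2.projective_points"
    unfolding bij_betw_def
  proof
    show "inj_on \<phi> M1.projective_points"
      using \<phi>(1) by (auto simp: bij_betw_def inj_on_def M1.projective_points_def)
    show "\<phi> ` M1.projective_points = M2.projective_points"
    proof (intro subset_antisym subsetI)
      fix L assume L: "L \<in> M2.projective_points"
      then obtain K where "K \<in> M1.subspaces" "L = \<phi> K"
        using \<phi>(1) by (auto simp: bij_betw_def M2.projective_points_def)
      then show "L \<in> \<phi> ` M1.projective_points"
        using L \<phi>(3) by (auto simp: M1.projective_points_def M2.projective_points_def)
    qed (use \<phi> in \<open>auto simp: bij_betw_def M1.projective_points_def M2.projective_points_def\<close>)
  qed
  have rank: "\<rho>2 (M2.span (\<Union>(\<phi> ` A))) = \<rho>1 (M1.span (\<Union>A))" if A: "A \<subseteq> M1.projective_points" for A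
  proof -
    let ?V = "M1.span (\<Union>A)" and ?W = "M2.span (\<Union>(\<phi> ` A))"
    have A2: "\<phi> ` A \<subseteq> M2.projective_points"
      using A \<phi>_points by (auto simp: bij_betw_def)
    have V: "?V \<in> M1.subspaces" and W: "?W \<in> M2.subspaces"
      using M1.subspaces_span M2.subspaces_span M1.Union_points_subset[OF A] M2.Union_points_subset[OF A2]
      by auto
    \<comment> \<open>Whether a flat contains a set of points is decided point by point, and for a
      single point \<open>\<phi>\<close> is controlled by its closure.\<close>
    have above: "M1.cl ?V \<subseteq> F \<longleftrightarrow> M2.cl ?W \<subseteq> \<alpha> F" if F: "F \<in> M1.flats" for F
    proof -
      have "L \<subseteq> F \<longleftrightarrow> \<phi> L \<subseteq> \<alpha> F" if "L \<in> A" for L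
      proof -
        have L: "L \<in> M1.subspaces" "\<phi> L \<in> M2.subspaces"
          using that A A2 by (auto simp: M1.projective_points_def M2.projective_points_def)
        have "L \<subseteq> F \<longleftrightarrow> M1.cl L \<subseteq> F"
          using L F M1.cl_subset_flat_iff by auto
        also have "\<dots> \<longleftrightarrow> M2.cl (\<phi> L) \<subseteq> \<alpha> F"
          using mono[OF M1.cl_in_flats[OF L(1)] F] \<phi>(2)[OF L(1)] by simp
        also have "\<dots> \<longleftrightarrow> \<phi> L \<subseteq> \<alpha> F"
          using L order_iso_flat[OF F] M2.cl_subset_flat_iff by auto
        finally show ?thesis .
      qed
      then have "\<Union>A \<subseteq> F \<longleftrightarrow> \<Union>(\<phi> ` A) \<subseteq> \<alpha> F"
        by (simp add: Sup_le_iff)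
      moreover have "\<Union>A \<subseteq> F \<longleftrightarrow> M1.cl ?V \<subseteq> F"
        using M1.cl_subset_flat_iff[OF V F] M1.span_superset[of "\<Union>A"] M1.span_minimal[of "\<Union>A" F] F
        by (auto simp: M1.flats_iff M1.subspaces_iff)
      moreover have "\<Union>(\<phi> ` A) \<subseteq> \<alpha> F \<longleftrightarrow> M2.cl ?W \<subseteq> \<alpha> F"
        using M2.cl_subset_flat_iff[OF W order_iso_flat[OF F]] M2.span_superset[of "\<Union>(\<phi> ` A)"]
          M2.span_minimal[of "\<Union>(\<phi> ` A)" "\<alpha> F"] order_iso_flat[OF F]
        by (auto simp: M2.flats_iff M2.subspaces_iff)
      ultimately show ?thesis
        by simp
    qed
    \<comment> \<open>Testing \<open>above\<close> on the preimage of \<open>M2.cl ?W\<close> and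
      then on \<open>M1.cl ?V\<close> gives the two inclusions.\<close>
    obtain F where F: "F \<in> M1.flats" "\<alpha> F = M2.cl ?W"
      using order_iso_preimage M2.cl_in_flats[OF W] by blast
    have "M1.cl ?V \<subseteq> F"
      using above[OF F(1)] F(2) by simp
    then have "\<alpha> (M1.cl ?V) \<subseteq> M2.cl ?W"
      using mono[OF M1.cl_in_flats[OF V] F(1)] F by simp
    moreover have "M2.cl ?W \<subseteq> \<alpha> (M1.cl ?V)"
      using above[OF M1.cl_in_flats[OF V]] by simp
    ultimately have "M2.cl ?W = \<alpha> (M1.cl ?V)"
      by simp
    then show ?thesis
      using rank_order_iso[OF M1.cl_in_flats[OF V]] M1.rank_cl[OF V] M2.rank_cl[OF W] by simp
  qed
  show ?thesis
    unfolding matroid_isomorphic_def M1.projectivization_def M2.projectivization_def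
    using \<phi>_points rank by auto
qed

end

section \<open>From an isomorphism of projectivizations to the flats\<close>

text \<open>Flats are visible in the ranks of sets of points: a point lies in \<open>F\<close>
  exactly if adjoining it to the points of \<open>F\<close> does not raise the rank, and
  \<open>\<beta>\<close> preserves these ranks.\<close>

lemma points_iso_flat:
  assumes bij: "bij_betw \<beta> M1.projective_points M2.projective_points"
    and rank: "\<And>A. A \<subseteq> M1.projective_points \<Longrightarrow> \<rho>2 (M2.span (\<Union>(\<beta> ` A))) = \<rho>1 (M1.span (\<Union>A))"
    and F: "F \<in> M1.flats"
  shows "M2.span (\<Union>(\<beta> ` M1.points_in F)) \<in> M2.flats"
    and "M2.points_in (M2.span (\<Union>(\<beta> ` M1.points_in F))) = \<beta> ` M1.points_in F"
proof -
  let ?P = "M1.points_in F" and ?G = "M2.span (\<Union>(\<beta> ` M1.points_in F))"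
  have P: "?P \<subseteq> M1.projective_points"
    by (auto simp: M1.points_in_def)
  then have P2: "\<beta> ` ?P \<subseteq> M2.projective_points"
    using bij by (auto simp: bij_betw_def)
  have Fs: "F \<in> M1.subspaces" "M1.cl F = F"
    using F by (auto simp: M1.flats_iff)
  have G: "?G \<in> M2.subspaces"
    using M2.subspaces_span M2.Union_points_subset[OF P2] by auto
  have closed: "\<beta> L \<subseteq> M2.cl ?G \<longleftrightarrow> L \<in> ?P" if L: "L \<in> M1.projective_points" for L
  proof -
    have L2: "\<beta> L \<in> M2.projective_points"
      using L bij by (auto simp: bij_betw_def)
    have "\<beta> L \<subseteq> M2.cl ?G \<longleftrightarrow> \<rho>2 (?G + \<beta> L) = \<rho>2 ?G"
      using L2 G by (intro M2.subset_cl_iff) (auto simp: M2.projective_points_def)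
    also have "?G + \<beta> L = M2.span (\<Union>(\<beta> ` insert L ?P))"
      using M2.span_Union_insert[OF P2 L2] by simp
    also have "\<rho>2 (M2.span (\<Union>(\<beta> ` insert L ?P))) = \<rho>1 (M1.span (\<Union>(insert L ?P)))"
      using L P by (intro rank) auto
    also have "M1.span (\<Union>(insert L ?P)) = F + L"
      using M1.span_Union_insert[OF P L] M1.span_points_in[OF Fs(1)] by simp
    also have "\<rho>2 ?G = \<rho>1 F"
      using rank[OF P] M1.span_points_in[OF Fs(1)] by simp
    also have "\<rho>1 (F + L) = \<rho>1 F \<longleftrightarrow> L \<subseteq> F"
      using M1.subset_cl_iff[OF Fs(1), of L] L Fs by (auto simp: M1.projective_points_def)
    finally show ?thesis
      using L by (simp add: M1.points_in_def)
  qed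
  have points_cl: "M2.points_in (M2.cl ?G) = \<beta> ` ?P"
  proof (intro subset_antisym subsetI)
    fix L assume L: "L \<in> M2.points_in (M2.cl ?G)"
    then have "L \<in> \<beta> ` M1.projective_points"
      using bij_betw_imp_surj_on[OF bij] by (simp add: M2.points_in_def)
    then obtain K where "K \<in> M1.projective_points" "L = \<beta> K"
      by blast
    then show "L \<in> \<beta> ` ?P"
      using closed L by (auto simp: M2.points_in_def)
  qed (use closed P P2 in \<open>auto simp: M2.points_in_def\<close>)
  \<comment> \<open>\<open>M2.cl ?G\<close> is spanned by its points, and these are exactly the
    generators of \<open>?G\<close>.\<close>
  have "M2.cl ?G = ?G"
    using M2.span_points_in[OF M2.cl_in_subspaces[OF G]] points_cl by simp
  then show "?G \<in> M2.flats" "M2.points_in ?G = \<beta> ` ?P"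
    using G points_cl by (simp_all add: M2.flats_iff)
qed

lemma projectivization_iso_imp_weakly_isomorphic:
  assumes "matroid_isomorphic M1.projectivization M2.projectivization"
  shows "weakly_isomorphic scale1 E1 \<rho>1 scale2 E2 \<rho>2"
proof -
  interpret swap: q_matroid_pair scale2 E2 \<rho>2 scale1 E1 \<rho>1
    by (rule swap)
  obtain \<beta> where bij: "bij_betw \<beta> M1.projective_points M2.projective_points"
    and rank: "\<And>A. A \<subseteq> M1.projective_points \<Longrightarrow> \<rho>2 (M2.span (\<Union>(\<beta> ` A))) = \<rho>1 (M1.span (\<Union>A))"
    using assms unfolding matroid_isomorphic_def M1.projectivization_def M2.projectivization_def by auto
  define \<gamma> where "\<gamma> = the_inv_into M1.projective_points \<beta>"
  have bij': "bij_betw \<gamma> M2.projective_points M1.projective_points"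
    unfolding \<gamma>_def by (rule bij_betw_the_inv_into[OF bij])
  have \<beta>\<gamma>: "\<beta> ` \<gamma> ` A = A" if "A \<subseteq> M2.projective_points" for A
  proof -
    have "\<beta> (\<gamma> L) = L" if "L \<in> A" for L
      using that \<open>A \<subseteq> _\<close> unfolding \<gamma>_def by (intro f_the_inv_into_f_bij_betw[OF bij]) auto
    then show ?thesis
      by (simp add: image_image)
  qed
  have rank': "\<rho>1 (M1.span (\<Union>(\<gamma> ` A))) = \<rho>2 (M2.span (\<Union>A))" if A: "A \<subseteq> M2.projective_points" for A
    using rank[of "\<gamma> ` A"] \<beta>\<gamma>[OF A] image_mono[OF A, of \<gamma>] bij_betw_imp_surj_on[OF bij'] by simp
  define \<alpha> where "\<alpha> F = M2.span (\<Union>(\<beta> ` M1.points_in F))" for F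
  have flat: "\<alpha> F \<in> M2.flats" and points: "M2.points_in (\<alpha> F) = \<beta> ` M1.points_in F"
    if "F \<in> M1.flats" for F
    using points_iso_flat[OF bij rank that] by (simp_all add: \<alpha>_def)
  \<comment> \<open>Comparing two images for inclusion requires injectivity on both point sets at
    once.\<close>
  have inj: "inj_on \<beta> (M1.points_in F \<union> M1.points_in G)" for F G
    using bij by (rule inj_on_subset[OF bij_betw_imp_inj_on]) (auto simp: M1.points_in_def)
  have mono: "\<alpha> F \<subseteq> \<alpha> G \<longleftrightarrow> F \<subseteq> G" if FG: "F \<in> M1.flats" "G \<in> M1.flats" for F G
  proof -
    have "\<alpha> F \<subseteq> \<alpha> G \<longleftrightarrow> M2.points_in (\<alpha> F) \<subseteq> M2.points_in (\<alpha> G)"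
      using flat FG M2.points_in_subset_iff by (auto simp: M2.flats_iff)
    also have "\<dots> \<longleftrightarrow> M1.points_in F \<subseteq> M1.points_in G"
      using points FG inj_on_Un_image_eq_iff[of \<beta> "M1.points_in F \<union> M1.points_in G" "M1.points_in G"]
        inj[of F G] by (simp add: image_Un subset_Un_eq Un_assoc)
    also have "\<dots> \<longleftrightarrow> F \<subseteq> G"
      using FG M1.points_in_subset_iff by (auto simp: M1.flats_iff)
    finally show ?thesis .
  qed
  have "bij_betw \<alpha> M1.flats M2.flats"
    unfolding bij_betw_def
  proof
    show "inj_on \<alpha> M1.flats"
      using mono by (intro inj_onI) (metis order_refl subset_antisym)
    show "\<alpha> ` M1.flats = M2.flats"
    proof (intro subset_antisym subsetI)
      fix G assume G: "G \<in> M2.flats"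
      \<comment> \<open>Built from \<open>\<gamma>\<close> as \<open>\<alpha>\<close> is from
        \<open>\<beta>\<close>, so the lemma for the swapped pair identifies its points.\<close>
      let ?F = "M1.span (\<Union>(\<gamma> ` M2.points_in G))"
      have "M1.points_in ?F = \<gamma> ` M2.points_in G" "?F \<in> M1.flats"
        using swap.points_iso_flat[OF bij' rank' G] by auto
      moreover have "\<beta> ` \<gamma> ` M2.points_in G = M2.points_in G"
        by (rule \<beta>\<gamma>) (auto simp: M2.points_in_def)
      ultimately have "\<alpha> ?F = G"
        using M2.span_points_in[of G] G by (simp add: \<alpha>_def M2.flats_iff)
      then show "G \<in> \<alpha> ` M1.flats"
        using \<open>?F \<in> M1.flats\<close> by blast
    qed (use flat in auto)
  qed
  moreover have "M2.dim (\<alpha> F) = M1.dim F" if F: "F \<in> M1.flats" for F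
  proof -
    have "card (M2.points_in (\<alpha> F)) = card (M1.points_in F)"
      using points[OF F] inj[of F F] by (simp add: card_image)
    then show ?thesis
      using dim_eq_if_card_points_in_eq[of F "\<alpha> F"] F flat[OF F] by (simp add: M1.flats_iff M2.flats_iff)
  qed
  ultimately show ?thesis
    using order_iso_imp_weakly_isomorphic mono by blast
qed

end

theorem theorem6p6:
  fixes scale1 :: "'f::{field,finite} \<Rightarrow> 'a::ab_group_add \<Rightarrow> 'a"
    and E1 :: "'a set" and \<rho>1 :: "'a set \<Rightarrow> nat"
    and scale2 :: "'f \<Rightarrow> 'b::ab_group_add \<Rightarrow> 'b"
    and E2 :: "'b set" and \<rho>2 :: "'b set \<Rightarrow> nat"
  assumes "q_matroid scale1 E1 \<rho>1"
    and "q_matroid scale2 E2 \<rho>2"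
  shows "(matroid_isomorphic
            (q_matroid.projectivization scale1 E1 \<rho>1) (q_matroid.projectivization scale2 E2 \<rho>2)
          \<longleftrightarrow> weakly_isomorphic scale1 E1 \<rho>1 scale2 E2 \<rho>2)
    \<and> (weakly_isomorphic scale1 E1 \<rho>1 scale2 E2 \<rho>2
          \<longrightarrow> q_matroid.whitney scale1 E1 \<rho>1 = q_matroid.whitney scale2 E2 \<rho>2)"
proof -
  interpret q_matroid_pair scale1 E1 \<rho>1 scale2 E2 \<rho>2
    using assms by (simp add: q_matroid_pair_def)
  show ?thesis
    using projectivization_iso_imp_weakly_isomorphic weakly_isomorphic_imp_order_iso
      order_iso_projectivization order_iso_whitney by metis
qed

end
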